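(* Let $X$ be a $\check C_0^{\mathbf r}$-complete flow. Then: (i) $L^{\mathbf r}(X)$ is a global weak attractor of $X$ and $L^{\mathbf r}(X)=C(X)$. (ii) If $X$ is $T_1$, then $L^{\mathbf r}(X)$ is a minimal global weak attractor of $X$ and $L^{\mathbf r}(X)=P(X)$. (iii) If $X$ is $T_2$, then $L^{\mathbf r}(X)$ is the unique minimal global attractor of $X$ and $L^{\mathbf r}(X)=\overline{\Omega^{\mathbf r}(X)}$. (iv) If $X$ is locally compact and $T_3$, then $L^{\mathbf r}(X)=\overline{\Omega^{\mathbf r}(X)}=\bar L^{\mathbf r}(X)$.
   Context: Flows: a flow on a topological space $X$ is a continuous action $\mathbb R\times X\to X$, $(t,x)\mapsto t\cdot x$, of the additive group $\mathbb R$. $C(X)$ is the set of critical points ($t\cdot x=x$ for all $t$), $P(X)$ the set of periodic points ($r\cdot x=x$ for some $r\neq0$). $\omega^{\mathbf r}(x)=\bigcap_{t\ge 0}\overline{[t,+\infty)\cdot x}$ and $\Omega^{\mathbf r}(X)=\bigcup_{x\in X}\omega^{\mathbf r}(x)$. An invariant subspace $M\subset X$ is a global weak attractor if $\omega^{\mathbf r}(x)\cap M\neq\emptyset$ for every $x\in X$, and a global attractor if $\omega^{\mathbf r}(x)\neq\emptyset$ and $\omega^{\mathbf r}(x)\subset M$ for every $x\in X$. Minimality is with respect to inclusion. $T_3$ means regular and $T_1$. Exterior spaces: an exterior space is a topological space $X$ with a nonempty family $\varepsilon(X)$ of open subsets (an externology) closed under finite intersections and under passing to larger open subsets. For a space $Y$,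 $\pi_0(Y)$ is the set of path-components with the quotient topology of $q_0\colon Y\to\pi_0(Y)$. $L(X)=\bigcap_{E\in\varepsilon(X)}E$ and $\bar L(X)=\bigcap_{E\in\varepsilon(X)}\overline E$ (subspace topologies); $\check\pi_0(X)=\lim_{E\in\varepsilon(X)}\pi_0(E)$ (inverse limit topology), with projections $\eta_{0,E}\colon\check\pi_0(X)\to\pi_0(E)$; $e_0\colon L(X)\to\check\pi_0(X)$ sends $x$ to the family of path-components of $x$ in the sets $E$. Completion: $\check C_0(X)$ has underlying set the push-out $X\cup_{L(X)}\check\pi_0(X)$ of the inclusion $L(X)\to X$ and $e_0$, with canonical maps $p_0\colon X\to\check C_0(X)$, $\operatorname{in}_0\colon\check\pi_0(X)\to\check C_0(X)$. A subset $W$ is open iff (a) $p_0^{-1}(W)$ and $\operatorname{in}_0^{-1}(W)$ are open, and (b) for each $a\in\operatorname{in}_0^{-1}(W)$ there are $E\in\varepsilon(X)$ and an open $G\subset\pi_0(E)$ with $a\in\eta_{0,E}^{-1}(G)\subset\operatorname{in}_0^{-1}(W)$ and $q_0^{-1}(G)\subset p_0^{-1}(W)$. Functors on flows: for a flow $X$, $X^{\mathbf r}$ denotes $X$ with the externology $\varepsilon^{\mathbf r}(X)$ of all open $N\subset X$ such that for every $x\in X$ there is $t_0\in\mathbb R$ with $t\cdot x\in N$ for all $t>t_0$. $L^{\mathbf r}(X)=L(X^{\mathbf r})$, $\bar L^{\mathbf r}(X)=\bar L(X^{\mathbf r})$, and $\check C_0^{\mathbf r}(X)$ is the space $\check C_0(X^{\mathbf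 r})$ with the flow $t\cdot p_0(x)=p_0(t\cdot x)$, $t\cdot\operatorname{in}_0(a)=\operatorname{in}_0(a)$. A flow $X$ is $\check C_0^{\mathbf r}$-complete if $p_0\colon X\to\check C_0^{\mathbf r}(X)$ is a homeomorphism. *)

theory Defs
  imports "HOL-Analysis.Analysis"
begin

section \<open>Flows\<close>

definition flow :: "'a topology \<Rightarrow> (real \<Rightarrow> 'a \<Rightarrow> 'a) \<Rightarrow> bool" where
  "flow X \<phi> \<longleftrightarrow>
     continuous_map (prod_topology euclideanreal X) X (\<lambda>(t, x). \<phi> t x) \<and>
     (\<forall>x \<in> topspace X. \<phi> 0 x = x) \<and>
     (\<forall>s t. \<forall>x \<in> topspace X. \<phi> s (\<phi> t x) = \<phi> (s + t) x)"

definition critical_points :: "'a topology \<Rightarrow> (real \<Rightarrow> 'a \<Rightarrow> 'a) \<Rightarrow> 'a set" where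
  "critical_points X \<phi> = {x \<in> topspace X. \<forall>t. \<phi> t x = x}"

definition periodic_points :: "'a topology \<Rightarrow> (real \<Rightarrow> 'a \<Rightarrow> 'a) \<Rightarrow> 'a set" where
  "periodic_points X \<phi> = {x \<in> topspace X. \<exists>r. r \<noteq> 0 \<and> \<phi> r x = x}"

definition omega_limit :: "'a topology \<Rightarrow> (real \<Rightarrow> 'a \<Rightarrow> 'a) \<Rightarrow> 'a \<Rightarrow> 'a set" where
  "omega_limit X \<phi> x = (\<Inter>t \<in> {0..}. X closure_of ((\<lambda>s. \<phi> s x) ` {t..}))"

definition Omega :: "'a topology \<Rightarrow> (real \<Rightarrow> 'a \<Rightarrow> 'a) \<Rightarrow> 'a set" where
  "Omega X \<phi> = (\<Union>x \<in> topspace X. omega_limit X \<phi> x)"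

definition invariant_subset :: "'a topology \<Rightarrow> (real \<Rightarrow> 'a \<Rightarrow> 'a) \<Rightarrow> 'a set \<Rightarrow> bool" where
  "invariant_subset X \<phi> M \<longleftrightarrow> M \<subseteq> topspace X \<and> (\<forall>t. \<forall>x \<in> M. \<phi> t x \<in> M)"

definition global_weak_attractor :: "'a topology \<Rightarrow> (real \<Rightarrow> 'a \<Rightarrow> 'a) \<Rightarrow> 'a set \<Rightarrow> bool" where
  "global_weak_attractor X \<phi> M \<longleftrightarrow>
     invariant_subset X \<phi> M \<and> (\<forall>x \<in> topspace X. omega_limit X \<phi> x \<inter> M \<noteq> {})"

definition global_attractor :: "'a topology \<Rightarrow> (real \<Rightarrow> 'a \<Rightarrow> 'a) \<Rightarrow> 'a set \<Rightarrow> bool" where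
  "global_attractor X \<phi> M \<longleftrightarrow>
     invariant_subset X \<phi> M \<and>
     (\<forall>x \<in> topspace X. omega_limit X \<phi> x \<noteq> {} \<and> omega_limit X \<phi> x \<subseteq> M)"

definition inclusion_minimal :: "('a set \<Rightarrow> bool) \<Rightarrow> 'a set \<Rightarrow> bool" where
  "inclusion_minimal P M \<longleftrightarrow> P M \<and> (\<forall>N. P N \<and> N \<subseteq> M \<longrightarrow> N = M)"


section \<open>Exterior spaces\<close>

definition externology :: "'a topology \<Rightarrow> 'a set set \<Rightarrow> bool" where
  "externology X \<epsilon> \<longleftrightarrow>
     \<epsilon> \<noteq> {} \<and> (\<forall>E \<in> \<epsilon>. openin X E) \<and>
     (\<forall>E \<in> \<epsilon>. \<forall>E' \<in> \<epsilon>. E \<inter> E' \<in> \<epsilon>) \<and>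
     (\<forall>E \<in> \<epsilon>. \<forall>U. openin X U \<and> E \<subseteq> U \<longrightarrow> U \<in> \<epsilon>)"

definition ext_limit :: "'a set set \<Rightarrow> 'a set" where
  "ext_limit \<epsilon> = \<Inter>\<epsilon>"

definition ext_bar_limit :: "'a topology \<Rightarrow> 'a set set \<Rightarrow> 'a set" where
  "ext_bar_limit X \<epsilon> = (\<Inter>E \<in> \<epsilon>. X closure_of E)"

abbreviation q0 :: "'a topology \<Rightarrow> 'a \<Rightarrow> 'a set" where
  "q0 Y \<equiv> path_component_of_set Y"

definition pi0 :: "'a topology \<Rightarrow> 'a set topology" where
  "pi0 Y = topology (\<lambda>G. G \<subseteq> path_components_of Y \<and> openin Y {x \<in> topspace Y. q0 Y x \<in> G})"

lemma openin_pi0: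
  "openin (pi0 Y) G \<longleftrightarrow> G \<subseteq> path_components_of Y \<and> openin Y {x \<in> topspace Y. q0 Y x \<in> G}"
proof -
  have "istopology (\<lambda>G. G \<subseteq> path_components_of Y \<and> openin Y {x \<in> topspace Y. q0 Y x \<in> G})"
    unfolding istopology_def
  proof (intro conjI allI impI)
    fix S T :: "'a set set"
    assume S: "S \<subseteq> path_components_of Y \<and> openin Y {x \<in> topspace Y. q0 Y x \<in> S}"
      and T: "T \<subseteq> path_components_of Y \<and> openin Y {x \<in> topspace Y. q0 Y x \<in> T}"
    show "S \<inter> T \<subseteq> path_components_of Y" using S by blast
    have "{x \<in> topspace Y. q0 Y x \<in> S \<inter> T}
        = {x \<in> topspace Y. q0 Y x \<in> S} \<inter> {x \<in> topspace Y. q0 Y x \<in> T}" by blast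
    then show "openin Y {x \<in> topspace Y. q0 Y x \<in> S \<inter> T}" using S T by auto
  next
    fix \<K> :: "'a set set set"
    assume K: "\<forall>K \<in> \<K>. K \<subseteq> path_components_of Y \<and> openin Y {x \<in> topspace Y. q0 Y x \<in> K}"
    show "\<Union>\<K> \<subseteq> path_components_of Y" using K by blast
    have "{x \<in> topspace Y. q0 Y x \<in> \<Union>\<K>} = (\<Union>K \<in> \<K>. {x \<in> topspace Y. q0 Y x \<in> K})" by blast
    then show "openin Y {x \<in> topspace Y. q0 Y x \<in> \<Union>\<K>}" using K by auto
  qed
  then show ?thesis by (simp add: pi0_def topology_inverse')
qed

lemma topspace_pi0: "topspace (pi0 Y) = path_components_of Y"
proof -
  have "openin (pi0 Y) (path_components_of Y)"
  proof -
    have "{x \<in> topspace Y. q0 Y x \<in> path_components_of Y} = topspace Y"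
      by (auto simp: path_components_of_def)
    then show ?thesis by (simp add: openin_pi0)
  qed
  then show ?thesis
    by (metis openin_pi0 openin_subset openin_topspace subset_antisym)
qed

lemma quotient_map_q0: "quotient_map Y (pi0 Y) (q0 Y)"
  by (auto simp: quotient_map_def topspace_pi0 openin_pi0 path_components_of_def)

text \<open>The bonding map of the inverse system, for \<open>E \<subseteq> E'\<close>, sends the path-component of a point
  \<open>x\<close> in \<open>E\<close> to its path-component in \<open>E'\<close>; \<open>x\<close> below ranges over all representatives
  of the class \<open>a E\<close>.\<close>

definition lim_pi0 :: "'a topology \<Rightarrow> 'a set set \<Rightarrow> ('a set \<Rightarrow> 'a set) topology" where
  "lim_pi0 X \<epsilon> =
     subtopology (product_topology (\<lambda>E. pi0 (subtopology X E)) \<epsilon>)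
       {a. \<forall>E \<in> \<epsilon>. \<forall>E' \<in> \<epsilon>. E \<subseteq> E' \<longrightarrow> (\<forall>x \<in> a E. q0 (subtopology X E') x = a E')}"

lemma topspace_lim_pi0:
  "topspace (lim_pi0 X \<epsilon>) =
     {a \<in> (\<Pi>\<^sub>E E\<in>\<epsilon>. path_components_of (subtopology X E)).
        \<forall>E \<in> \<epsilon>. \<forall>E' \<in> \<epsilon>. E \<subseteq> E' \<longrightarrow> (\<forall>x \<in> a E. q0 (subtopology X E') x = a E')}"
  unfolding lim_pi0_def topspace_subtopology topspace_product_topology topspace_pi0 o_def
    Int_def mem_Collect_eq by (rule refl)

definition e0 :: "'a topology \<Rightarrow> 'a set set \<Rightarrow> 'a \<Rightarrow> ('a set \<Rightarrow> 'a set)" where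
  "e0 X \<epsilon> x = (\<lambda>E \<in> \<epsilon>. q0 (subtopology X E) x)"


section \<open>The completion\<close>

text \<open>The points of the push-out are the classes of the disjoint union of \<open>X\<close> and the inverse
  limit for the equivalence relation generated by \<open>x \<sim> e0 x\<close>, \<open>x \<in> L(X)\<close>.\<close>

definition glue_gen :: "'a topology \<Rightarrow> 'a set set \<Rightarrow> ('a + ('a set \<Rightarrow> 'a set)) rel" where
  "glue_gen X \<epsilon> = {(Inl x, Inr (e0 X \<epsilon> x)) | x. x \<in> ext_limit \<epsilon>}"

definition glue :: "'a topology \<Rightarrow> 'a set set \<Rightarrow> ('a + ('a set \<Rightarrow> 'a set)) rel" where
  "glue X \<epsilon> =
     (glue_gen X \<epsilon> \<union> (glue_gen X \<epsilon>)\<inverse>)\<^sup>* \<inter>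
     (topspace X <+> topspace (lim_pi0 X \<epsilon>)) \<times> (topspace X <+> topspace (lim_pi0 X \<epsilon>))"

definition C0_points :: "'a topology \<Rightarrow> 'a set set \<Rightarrow> ('a + ('a set \<Rightarrow> 'a set)) set set" where
  "C0_points X \<epsilon> = (topspace X <+> topspace (lim_pi0 X \<epsilon>)) // glue X \<epsilon>"

definition p0 :: "'a topology \<Rightarrow> 'a set set \<Rightarrow> 'a \<Rightarrow> ('a + ('a set \<Rightarrow> 'a set)) set" where
  "p0 X \<epsilon> x = glue X \<epsilon> `` {Inl x}"

definition in0 ::
  "'a topology \<Rightarrow> 'a set set \<Rightarrow> ('a set \<Rightarrow> 'a set) \<Rightarrow> ('a + ('a set \<Rightarrow> 'a set)) set" where
  "in0 X \<epsilon> a = glue X \<epsilon> `` {Inr a}"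

definition C0_open ::
  "'a topology \<Rightarrow> 'a set set \<Rightarrow> ('a + ('a set \<Rightarrow> 'a set)) set set \<Rightarrow> bool" where
  "C0_open X \<epsilon> W \<longleftrightarrow>
     W \<subseteq> C0_points X \<epsilon> \<and>
     openin X {x \<in> topspace X. p0 X \<epsilon> x \<in> W} \<and>
     openin (lim_pi0 X \<epsilon>) {a \<in> topspace (lim_pi0 X \<epsilon>). in0 X \<epsilon> a \<in> W} \<and>
     (\<forall>a \<in> topspace (lim_pi0 X \<epsilon>). in0 X \<epsilon> a \<in> W \<longrightarrow>
        (\<exists>E \<in> \<epsilon>. \<exists>G. openin (pi0 (subtopology X E)) G \<and> a E \<in> G \<and>
           {b \<in> topspace (lim_pi0 X \<epsilon>). b E \<in> G} \<subseteq> {b \<in> topspace (lim_pi0 X \<epsilon>). in0 X \<epsilon> b \<in> W} \<and>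
           {x \<in> E. q0 (subtopology X E) x \<in> G} \<subseteq> {x \<in> topspace X. p0 X \<epsilon> x \<in> W}))"

definition C0 :: "'a topology \<Rightarrow> 'a set set \<Rightarrow> ('a + ('a set \<Rightarrow> 'a set)) set topology" where
  "C0 X \<epsilon> = topology (C0_open X \<epsilon>)"

lemma equiv_glue: "equiv (topspace X <+> topspace (lim_pi0 X \<epsilon>)) (glue X \<epsilon>)"
proof -
  have "sym ((glue_gen X \<epsilon> \<union> (glue_gen X \<epsilon>)\<inverse>)\<^sup>*)"
    by (intro sym_rtrancl sym_Un_converse)
  then show ?thesis
    unfolding glue_def
    by (intro equivI sym_Int trans_Int trans_rtrancl) (auto simp: refl_on_def intro: symI transI)
qed

lemma istopology_C0_open:
  assumes ext: "externology X \<epsilon>"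
  shows "istopology (C0_open X \<epsilon>)"
  unfolding istopology_def
proof (intro conjI allI impI)
  fix S T
  assume S: "C0_open X \<epsilon> S" and T: "C0_open X \<epsilon> T"
  show "C0_open X \<epsilon> (S \<inter> T)"
    unfolding C0_open_def
  proof (intro conjI ballI impI)
    show "S \<inter> T \<subseteq> C0_points X \<epsilon>" using S by (auto simp: C0_open_def)
    have "{x \<in> topspace X. p0 X \<epsilon> x \<in> S \<inter> T}
        = {x \<in> topspace X. p0 X \<epsilon> x \<in> S} \<inter> {x \<in> topspace X. p0 X \<epsilon> x \<in> T}" by blast
    then show "openin X {x \<in> topspace X. p0 X \<epsilon> x \<in> S \<inter> T}"
      using S T by (auto simp: C0_open_def)
    have "{a \<in> topspace (lim_pi0 X \<epsilon>). in0 X \<epsilon> a \<in> S \<inter> T}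
        = {a \<in> topspace (lim_pi0 X \<epsilon>). in0 X \<epsilon> a \<in> S} \<inter> {a \<in> topspace (lim_pi0 X \<epsilon>). in0 X \<epsilon> a \<in> T}"
      by blast
    then show "openin (lim_pi0 X \<epsilon>) {a \<in> topspace (lim_pi0 X \<epsilon>). in0 X \<epsilon> a \<in> S \<inter> T}"
      using S T by (auto simp: C0_open_def)
  next
    fix a assume a: "a \<in> topspace (lim_pi0 X \<epsilon>)" "in0 X \<epsilon> a \<in> S \<inter> T"
    have "in0 X \<epsilon> a \<in> S" using a by blast
    then obtain E G where E0: "E \<in> \<epsilon>" "openin (pi0 (subtopology X E)) G" "a E \<in> G"
        "{b \<in> topspace (lim_pi0 X \<epsilon>). b E \<in> G} \<subseteq> {b \<in> topspace (lim_pi0 X \<epsilon>). in0 X \<epsilon> b \<in> S}"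
        "{x \<in> E. q0 (subtopology X E) x \<in> G} \<subseteq> {x \<in> topspace X. p0 X \<epsilon> x \<in> S}"
      using S a(1) unfolding C0_open_def by meson
    have E: "E \<in> \<epsilon>" "openin (pi0 (subtopology X E)) G" "a E \<in> G"
        "\<And>b. \<lbrakk>b \<in> topspace (lim_pi0 X \<epsilon>); b E \<in> G\<rbrakk> \<Longrightarrow> in0 X \<epsilon> b \<in> S"
        "\<And>x. \<lbrakk>x \<in> E; q0 (subtopology X E) x \<in> G\<rbrakk> \<Longrightarrow> x \<in> topspace X \<and> p0 X \<epsilon> x \<in> S"
      using E0(1-3) subsetD[OF E0(4)] subsetD[OF E0(5)] by simp_all
    have "in0 X \<epsilon> a \<in> T" using a by blast
    then obtain F H where F0: "F \<in> \<epsilon>" "openin (pi0 (subtopology X F)) H" "a F \<in> H"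
        "{b \<in> topspace (lim_pi0 X \<epsilon>). b F \<in> H} \<subseteq> {b \<in> topspace (lim_pi0 X \<epsilon>). in0 X \<epsilon> b \<in> T}"
        "{x \<in> F. q0 (subtopology X F) x \<in> H} \<subseteq> {x \<in> topspace X. p0 X \<epsilon> x \<in> T}"
      using T a(1) unfolding C0_open_def by meson
    have F: "F \<in> \<epsilon>" "openin (pi0 (subtopology X F)) H" "a F \<in> H"
        "\<And>b. \<lbrakk>b \<in> topspace (lim_pi0 X \<epsilon>); b F \<in> H\<rbrakk> \<Longrightarrow> in0 X \<epsilon> b \<in> T"
        "\<And>x. \<lbrakk>x \<in> F; q0 (subtopology X F) x \<in> H\<rbrakk> \<Longrightarrow> x \<in> topspace X \<and> p0 X \<epsilon> x \<in> T"
      using F0(1-3) subsetD[OF F0(4)] subsetD[OF F0(5)] by simp_all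
    define D where "D = E \<inter> F"
    have D: "D \<in> \<epsilon>" "D \<subseteq> E" "D \<subseteq> F" using ext E(1) F(1) unfolding externology_def D_def by blast+
    have opn: "openin X D" "openin X E" "openin X F" using ext D(1) E(1) F(1)
      unfolding externology_def by blast+
    have ts: "topspace (subtopology X D) = D" "topspace (subtopology X E) = E"
        "topspace (subtopology X F) = F"
      using opn[THEN openin_subset] by (auto simp only: topspace_subtopology_subset)
    define A where "A = {x \<in> D. q0 (subtopology X E) x \<in> G \<and> q0 (subtopology X F) x \<in> H}"
    define J where "J = q0 (subtopology X D) ` A"
    have mono: "q0 (subtopology X B) x = q0 (subtopology X B) y"
      if "D \<subseteq> B" "q0 (subtopology X D) x = q0 (subtopology X D) y" "x \<in> D" for x y B
    proof -
      have "x \<in> q0 (subtopology X D) x" using \<open>x \<in> D\<close> ts(1) by (simp add: path_component_of_refl)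
      then have "x \<in> q0 (subtopology X D) y" by (simp only: that(2))
      then have "path_component_of (subtopology X D) y x" by simp
      then have "path_component_of (subtopology X B) y x"
        unfolding path_component_of_def pathin_subtopology using \<open>D \<subseteq> B\<close> by blast
      then have "path_component_of (subtopology X B) y = path_component_of (subtopology X B) x"
        by (simp add: path_component_of_equiv)
      then show ?thesis by simp
    qed
    have JA: "x \<in> A" if xD: "x \<in> D" and xJ: "q0 (subtopology X D) x \<in> J" for x
    proof -
      obtain y where y: "y \<in> A" "q0 (subtopology X D) x = q0 (subtopology X D) y"
        using xJ unfolding J_def by (elim imageE)
      have "q0 (subtopology X E) y \<in> G" "q0 (subtopology X F) y \<in> H"
        using y(1) unfolding A_def by blast+
      then show ?thesis
        unfolding A_def mem_Collect_eq
          mono[OF D(2) y(2) xD] mono[OF D(3) y(2) xD] using xD by blast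
    qed
    have preJ: "{x \<in> D. q0 (subtopology X D) x \<in> J} = A"
    proof (intro equalityI subsetI)
      fix x assume "x \<in> {x \<in> D. q0 (subtopology X D) x \<in> J}"
      then show "x \<in> A" using JA by blast
    next
      fix x assume "x \<in> A"
      then show "x \<in> {x \<in> D. q0 (subtopology X D) x \<in> J}" unfolding J_def A_def by blast
    qed
    have "openin X {x \<in> E. q0 (subtopology X E) x \<in> G}" "openin X {x \<in> F. q0 (subtopology X F) x \<in> H}"
      using E(2) F(2) unfolding openin_pi0 ts openin_open_subtopology[OF opn(2)]
        openin_open_subtopology[OF opn(3)] by blast+
    moreover have "A = {x \<in> E. q0 (subtopology X E) x \<in> G} \<inter> {x \<in> F. q0 (subtopology X F) x \<in> H}"
      unfolding A_def D_def by blast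
    ultimately have "openin X A" by (simp only: openin_Int)
    moreover have "A \<subseteq> D" unfolding A_def by blast
    ultimately have "openin (subtopology X D) A"
      by (simp only: openin_open_subtopology[OF opn(1)])
    moreover have "J \<subseteq> path_components_of (subtopology X D)"
      unfolding path_components_of_def ts J_def using \<open>A \<subseteq> D\<close> by (rule image_mono)
    ultimately have Jopen: "openin (pi0 (subtopology X D)) J"
      unfolding openin_pi0 ts preJ by blast
    have rep: "\<exists>x \<in> D. q0 (subtopology X D) x = b D \<and>
                  q0 (subtopology X E) x = b E \<and> q0 (subtopology X F) x = b F"
      if "b \<in> topspace (lim_pi0 X \<epsilon>)" for b
    proof -
      note b = that[unfolded topspace_lim_pi0 mem_Collect_eq]
      have "b D \<in> q0 (subtopology X D) ` D"
        using PiE_mem[OF conjunct1[OF b] D(1)] unfolding path_components_of_def ts .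
      then obtain x where x: "b D = q0 (subtopology X D) x" "x \<in> D" by (elim imageE)
      have "x \<in> b D" unfolding x(1) using x(2) ts(1) by (simp add: path_component_of_refl)
      then show ?thesis
        using conjunct2[OF b, rule_format, OF D(1) E(1) D(2)]
          conjunct2[OF b, rule_format, OF D(1) F(1) D(3)] x by metis
    qed
    show "\<exists>E \<in> \<epsilon>. \<exists>G. openin (pi0 (subtopology X E)) G \<and> a E \<in> G \<and>
           {b \<in> topspace (lim_pi0 X \<epsilon>). b E \<in> G}
             \<subseteq> {b \<in> topspace (lim_pi0 X \<epsilon>). in0 X \<epsilon> b \<in> S \<inter> T} \<and>
           {x \<in> E. q0 (subtopology X E) x \<in> G} \<subseteq> {x \<in> topspace X. p0 X \<epsilon> x \<in> S \<inter> T}"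
    proof (intro bexI[of _ D] exI[of _ J] conjI)
      obtain x where x: "x \<in> D" "q0 (subtopology X D) x = a D"
          "q0 (subtopology X E) x = a E" "q0 (subtopology X F) x = a F"
        using rep[OF a(1)] by blast
      then have "x \<in> A" using E(3) F(3) unfolding A_def by simp
      then show "a D \<in> J" unfolding J_def x(2)[symmetric] by (rule imageI)
      show "{b \<in> topspace (lim_pi0 X \<epsilon>). b D \<in> J}
              \<subseteq> {b \<in> topspace (lim_pi0 X \<epsilon>). in0 X \<epsilon> b \<in> S \<inter> T}"
      proof
        fix b assume "b \<in> {b \<in> topspace (lim_pi0 X \<epsilon>). b D \<in> J}"
        then have b: "b \<in> topspace (lim_pi0 X \<epsilon>)" "b D \<in> J" by blast+
        obtain x where x: "x \<in> D" "q0 (subtopology X D) x = b D"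
            "q0 (subtopology X E) x = b E" "q0 (subtopology X F) x = b F"
          using rep[OF b(1)] by blast
        have "x \<in> A" using JA[OF x(1)] b(2) unfolding x(2) .
        then have "b E \<in> G" "b F \<in> H" unfolding A_def mem_Collect_eq x(3,4) by blast+
        then show "b \<in> {b \<in> topspace (lim_pi0 X \<epsilon>). in0 X \<epsilon> b \<in> S \<inter> T}"
          using E(4) F(4) b(1) by blast
      qed
      show "{x \<in> D. q0 (subtopology X D) x \<in> J} \<subseteq> {x \<in> topspace X. p0 X \<epsilon> x \<in> S \<inter> T}"
        unfolding preJ unfolding A_def using E(5) F(5) D(2,3) by blast
    qed (fact Jopen D(1))+
  qed
next
  fix \<K>
  assume K: "\<forall>K \<in> \<K>. C0_open X \<epsilon> K"
  show "C0_open X \<epsilon> (\<Union>\<K>)"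
    unfolding C0_open_def
  proof (intro conjI ballI impI)
    show "\<Union>\<K> \<subseteq> C0_points X \<epsilon>" using K by (auto simp: C0_open_def)
    have "{x \<in> topspace X. p0 X \<epsilon> x \<in> \<Union>\<K>} = (\<Union>K \<in> \<K>. {x \<in> topspace X. p0 X \<epsilon> x \<in> K})" by blast
    then show "openin X {x \<in> topspace X. p0 X \<epsilon> x \<in> \<Union>\<K>}"
      using K by (auto simp: C0_open_def)
    have "{a \<in> topspace (lim_pi0 X \<epsilon>). in0 X \<epsilon> a \<in> \<Union>\<K>}
        = (\<Union>K \<in> \<K>. {a \<in> topspace (lim_pi0 X \<epsilon>). in0 X \<epsilon> a \<in> K})" by blast
    then show "openin (lim_pi0 X \<epsilon>) {a \<in> topspace (lim_pi0 X \<epsilon>). in0 X \<epsilon> a \<in> \<Union>\<K>}"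
      using K by (auto simp: C0_open_def)
  next
    fix a assume a: "a \<in> topspace (lim_pi0 X \<epsilon>)" "in0 X \<epsilon> a \<in> \<Union>\<K>"
    then obtain K where "K \<in> \<K>" "in0 X \<epsilon> a \<in> K" by blast
    moreover from this obtain E G where "E \<in> \<epsilon>" "openin (pi0 (subtopology X E)) G" "a E \<in> G"
        "{b \<in> topspace (lim_pi0 X \<epsilon>). b E \<in> G} \<subseteq> {b \<in> topspace (lim_pi0 X \<epsilon>). in0 X \<epsilon> b \<in> K}"
        "{x \<in> E. q0 (subtopology X E) x \<in> G} \<subseteq> {x \<in> topspace X. p0 X \<epsilon> x \<in> K}"
      using K a(1) unfolding C0_open_def by meson
    ultimately show "\<exists>E \<in> \<epsilon>. \<exists>G. openin (pi0 (subtopology X E)) G \<and> a E \<in> G \<and>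
           {b \<in> topspace (lim_pi0 X \<epsilon>). b E \<in> G}
             \<subseteq> {b \<in> topspace (lim_pi0 X \<epsilon>). in0 X \<epsilon> b \<in> \<Union>\<K>} \<and>
           {x \<in> E. q0 (subtopology X E) x \<in> G} \<subseteq> {x \<in> topspace X. p0 X \<epsilon> x \<in> \<Union>\<K>}"
      by (intro bexI[of _ E] exI[of _ G]) blast+
  qed
qed

lemma openin_C0: "externology X \<epsilon> \<Longrightarrow> openin (C0 X \<epsilon>) = C0_open X \<epsilon>"
  by (simp add: C0_def istopology_C0_open topology_inverse')


section \<open>The exterior space of a flow\<close>

definition ext_r :: "'a topology \<Rightarrow> (real \<Rightarrow> 'a \<Rightarrow> 'a) \<Rightarrow> 'a set set" where
  "ext_r X \<phi> = {N. openin X N \<and> (\<forall>x \<in> topspace X. \<exists>t0. \<forall>t > t0. \<phi> t x \<in> N)}"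

lemma externology_ext_r:
  assumes "flow X \<phi>"
  shows "externology X (ext_r X \<phi>)"
proof -
  have in_space: "\<phi> t x \<in> topspace X" if "x \<in> topspace X" for t x
    using assms that unfolding flow_def continuous_map_def by force
  have "E \<inter> E' \<in> ext_r X \<phi>" if "E \<in> ext_r X \<phi>" "E' \<in> ext_r X \<phi>" for E E'
    unfolding ext_r_def
  proof (intro CollectI conjI ballI)
    show "openin X (E \<inter> E')" using that by (auto simp: ext_r_def)
    fix x assume "x \<in> topspace X"
    with that obtain s t where "\<forall>u > s. \<phi> u x \<in> E" "\<forall>u > t. \<phi> u x \<in> E'"
      by (auto simp: ext_r_def) metis
    then show "\<exists>t0. \<forall>t > t0. \<phi> t x \<in> E \<inter> E'" by (intro exI[of _ "max s t"]) auto
  qed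
  moreover have "topspace X \<in> ext_r X \<phi>" using in_space by (auto simp: ext_r_def)
  moreover have "U \<in> ext_r X \<phi>" if "E \<in> ext_r X \<phi>" "openin X U" "E \<subseteq> U" for E U
    using that unfolding ext_r_def by blast
  moreover have "openin X E" if "E \<in> ext_r X \<phi>" for E
    using that by (simp add: ext_r_def)
  ultimately show ?thesis unfolding externology_def by blast
qed

definition L_r :: "'a topology \<Rightarrow> (real \<Rightarrow> 'a \<Rightarrow> 'a) \<Rightarrow> 'a set" where
  "L_r X \<phi> = ext_limit (ext_r X \<phi>)"

definition L_bar_r :: "'a topology \<Rightarrow> (real \<Rightarrow> 'a \<Rightarrow> 'a) \<Rightarrow> 'a set" where
  "L_bar_r X \<phi> = ext_bar_limit X (ext_r X \<phi>)"

text \<open>Completeness asks only for a homeomorphism of spaces: \<open>p0\<close> is equivariant by the very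
  definition of the flow on the completion, which therefore does not enter.\<close>

definition C0_r_complete :: "'a topology \<Rightarrow> (real \<Rightarrow> 'a \<Rightarrow> 'a) \<Rightarrow> bool" where
  "C0_r_complete X \<phi> \<longleftrightarrow>
     flow X \<phi> \<and> homeomorphic_map X (C0 X (ext_r X \<phi>)) (p0 X (ext_r X \<phi>))"

end

theory Submission
  imports Defs
begin

text \<open>Completeness says two things about the exterior space \<open>X\<^sup>r\<close>. As the canonical map
  \<open>p0\<close> is bijective, \<open>e0\<close> is a bijection from the limit \<open>L\<close> onto the ends, i.e. the points of
  \<open>lim_pi0\<close>. As \<open>p0\<close> is moreover open, the topology of the completion, in particular the
  last clause of \<open>C0_open\<close>, is that of \<open>X\<close>: if \<open>e0 y = a\<close>, every neighbourhood of \<open>y\<close> contains all points of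
  some exterior open set \<open>E\<close> that lie in the path-component \<open>a E\<close>
  (\<open>limitin_of_end\<close>).

  A trajectory is eventually in every exterior open set \<open>E\<close>, and its tail is path-connected, so
  the path-components that contain its tails form an end. By the above, \<^emph>\<open>every trajectory
  converges to a point of\<close> \<open>L\<close> (\<open>complete_trajectory_converges\<close>). On the other hand \<open>L\<close> is
  invariant, so that the points of an orbit inside \<open>L\<close> are joined by paths inside \<open>L\<close> and have the
  same end; injectivity of \<open>e0\<close> makes them equal. Hence \<open>L\<close> consists of the critical points.

  The rest is elementary topology of convergent trajectories. The \<open>\<omega>\<close>-limit of a point of \<open>L\<close> is
  the closure of that point, and a periodic trajectory can converge in a \<open>T\<^sub>1\<close> space only if it is
  constant; this gives the minimality among weak attractors and the description by periodic
  points. In a Hausdorff space the \<open>\<omega>\<close>-limits are exactly the singletons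
  \<open>{y}\<close> with \<open>y \<in> L\<close>, and \<open>L\<close> is closed; this settles the global attractors. Finally, every open set around \<open>L\<close>
  is exterior since all trajectories end up in it, so regularity separates each point outside the
  closed set \<open>L\<close> from the closure of an exterior open set.\<close>

section \<open>Ends of complete exterior spaces\<close>

lemma path_component_of_subtopology_mono:
  assumes "path_component_of (subtopology X S) x y" "S \<subseteq> T"
  shows "path_component_of (subtopology X T) x y"
proof -
  obtain g where g: "pathin X g" "\<forall>u \<in> {0..1}. g u \<in> S" "g 0 = x" "g 1 = y"
    using assms(1) unfolding path_component_of_def pathin_subtopology by (elim exE conjE)
  have "\<forall>u \<in> {0..1}. g u \<in> T" using g(2) assms(2) by blast
  with g show ?thesis
    unfolding path_component_of_def pathin_subtopology by (intro exI[of _ g] conjI)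
qed

lemma q0_eqI:
  assumes "path_component_of Y x y"
  shows "q0 Y x = q0 Y y"
proof -
  have "path_component_of Y x = path_component_of Y y"
    using path_component_of_equiv[THEN iffD1, OF assms] by (elim conjE)
  then show ?thesis by (rule arg_cong)
qed

lemma ext_limit_subset_topspace:
  assumes "externology X \<epsilon>"
  shows "ext_limit \<epsilon> \<subseteq> topspace X"
proof -
  obtain E where "E \<in> \<epsilon>" "E \<subseteq> topspace X"
    using assms openin_subset unfolding externology_def by (metis ex_in_conv)
  then show ?thesis unfolding ext_limit_def by (meson Inter_lower order_trans)
qed

lemma e0_in_lim_pi0:
  assumes ext: "externology X \<epsilon>" and x: "x \<in> ext_limit \<epsilon>"
  shows "e0 X \<epsilon> x \<in> topspace (lim_pi0 X \<epsilon>)"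
proof -
  have "x \<in> topspace X" using ext_limit_subset_topspace[OF ext] x by blast
  then have xE: "x \<in> topspace (subtopology X E)" if "E \<in> \<epsilon>" for E
    using x that by (simp add: ext_limit_def)
  show ?thesis
    unfolding topspace_lim_pi0 e0_def
  proof (intro CollectI conjI PiE_I ballI impI)
    fix E assume "E \<in> \<epsilon>"
    then show "(\<lambda>E\<in>\<epsilon>. q0 (subtopology X E) x) E \<in> path_components_of (subtopology X E)"
      using xE unfolding path_components_of_def restrict_apply by (simp only: if_True) (rule imageI, rule xE)
  next
    fix E E' z
    assume E: "E \<in> \<epsilon>" and E': "E' \<in> \<epsilon>" and sub: "E \<subseteq> E'"
      and z: "z \<in> (\<lambda>E\<in>\<epsilon>. q0 (subtopology X E) x) E"
    have "path_component_of (subtopology X E) x z"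
      using z unfolding restrict_apply by (simp only: E if_True mem_Collect_eq)
    then have "q0 (subtopology X E') x = q0 (subtopology X E') z"
      by (intro q0_eqI path_component_of_subtopology_mono[OF _ sub])
    then show "q0 (subtopology X E') z = (\<lambda>E\<in>\<epsilon>. q0 (subtopology X E) x) E'"
      unfolding restrict_apply by (simp only: E' if_True)
  qed (simp only: restrict_apply if_False)
qed

text \<open>The identification made by the push-out.\<close>

lemma p0_eq_in0_e0:
  assumes "externology X \<epsilon>" "x \<in> ext_limit \<epsilon>"
  shows "p0 X \<epsilon> x = in0 X \<epsilon> (e0 X \<epsilon> x)"
proof -
  have "(Inl x, Inr (e0 X \<epsilon> x)) \<in> glue X \<epsilon>"
    using assms ext_limit_subset_topspace[OF assms(1)] e0_in_lim_pi0[OF assms]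
    unfolding glue_def glue_gen_def by blast
  then show ?thesis
    unfolding p0_def in0_def by (rule equiv_class_eq[OF equiv_glue])
qed

text \<open>An end can be glued to a point of \<open>X\<close> only through a chain of identifications, whose last
  link exhibits it as \<open>e0\<close> of a point of the limit.\<close>

lemma in0_eq_p0_imp_e0_image:
  assumes "a \<in> topspace (lim_pi0 X \<epsilon>)" "in0 X \<epsilon> a = p0 X \<epsilon> y"
  shows "a \<in> e0 X \<epsilon> ` ext_limit \<epsilon>"
proof -
  have "(Inr a, Inr a) \<in> glue X \<epsilon>"
    using assms(1) unfolding glue_def by blast
  then have "Inr a \<in> p0 X \<epsilon> y"
    unfolding assms(2)[symmetric] in0_def by blast
  then have "(Inl y, Inr a) \<in> (glue_gen X \<epsilon> \<union> (glue_gen X \<epsilon>)\<inverse>)\<^sup>*"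
    unfolding p0_def glue_def by blast
  then show ?thesis
    by (cases rule: rtranclE) (auto simp: glue_gen_def)
qed

lemma topspace_C0:
  assumes ext: "externology X \<epsilon>"
  shows "topspace (C0 X \<epsilon>) = C0_points X \<epsilon>"
proof -
  have p0: "p0 X \<epsilon> x \<in> C0_points X \<epsilon>" if "x \<in> topspace X" for x
    unfolding p0_def C0_points_def using that by (blast intro: quotientI)
  have in0: "in0 X \<epsilon> a \<in> C0_points X \<epsilon>" if "a \<in> topspace (lim_pi0 X \<epsilon>)" for a
    unfolding in0_def C0_points_def using that by (blast intro: quotientI)
  have "C0_open X \<epsilon> (C0_points X \<epsilon>)"
    unfolding C0_open_def
  proof (intro conjI ballI impI)
    have "{x \<in> topspace X. p0 X \<epsilon> x \<in> C0_points X \<epsilon>} = topspace X" using p0 by blast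
    then show "openin X {x \<in> topspace X. p0 X \<epsilon> x \<in> C0_points X \<epsilon>}" by simp
    have "{a \<in> topspace (lim_pi0 X \<epsilon>). in0 X \<epsilon> a \<in> C0_points X \<epsilon>} = topspace (lim_pi0 X \<epsilon>)"
      using in0 by blast
    then show "openin (lim_pi0 X \<epsilon>) {a \<in> topspace (lim_pi0 X \<epsilon>). in0 X \<epsilon> a \<in> C0_points X \<epsilon>}"
      by simp
  next
    fix a assume a: "a \<in> topspace (lim_pi0 X \<epsilon>)"
    obtain E where E: "E \<in> \<epsilon>" "E \<subseteq> topspace X"
      using ext openin_subset unfolding externology_def by (metis ex_in_conv)
    have "a E \<in> topspace (pi0 (subtopology X E))"
      using a E(1) unfolding topspace_lim_pi0 topspace_pi0 by blast
    then show "\<exists>E \<in> \<epsilon>. \<exists>G. openin (pi0 (subtopology X E)) G \<and> a E \<in> G \<and>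
        {b \<in> topspace (lim_pi0 X \<epsilon>). b E \<in> G}
          \<subseteq> {b \<in> topspace (lim_pi0 X \<epsilon>). in0 X \<epsilon> b \<in> C0_points X \<epsilon>} \<and>
        {x \<in> E. q0 (subtopology X E) x \<in> G} \<subseteq> {x \<in> topspace X. p0 X \<epsilon> x \<in> C0_points X \<epsilon>}"
      using E p0 in0
      by (intro bexI[of _ E] exI[of _ "topspace (pi0 (subtopology X E))"] conjI) blast+
  qed simp
  then have "openin (C0 X \<epsilon>) (C0_points X \<epsilon>)" by (simp add: openin_C0[OF ext])
  moreover have "C0_open X \<epsilon> (topspace (C0 X \<epsilon>))"
    by (metis openin_C0[OF ext] openin_topspace)
  then have "topspace (C0 X \<epsilon>) \<subseteq> C0_points X \<epsilon>"
    unfolding C0_open_def by blast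
  ultimately show ?thesis using openin_subset by blast
qed

lemma e0_inj_on_limit:
  assumes ext: "externology X \<epsilon>" and inj: "inj_on (p0 X \<epsilon>) (topspace X)"
  shows "inj_on (e0 X \<epsilon>) (ext_limit \<epsilon>)"
  using p0_eq_in0_e0[OF ext] ext_limit_subset_topspace[OF ext] inj
  unfolding inj_on_def by (metis subsetD)

lemma e0_surj_on_ends:
  assumes ext: "externology X \<epsilon>" and surj: "p0 X \<epsilon> ` topspace X = topspace (C0 X \<epsilon>)"
    and a: "a \<in> topspace (lim_pi0 X \<epsilon>)"
  obtains y where "y \<in> ext_limit \<epsilon>" "e0 X \<epsilon> y = a"
proof -
  have "in0 X \<epsilon> a \<in> topspace (C0 X \<epsilon>)"
    unfolding topspace_C0[OF ext] in0_def C0_points_def using a by (blast intro: quotientI)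
  then obtain y where "in0 X \<epsilon> a = p0 X \<epsilon> y" using surj by (metis imageE)
  then show ?thesis using in0_eq_p0_imp_e0_image[OF a] that by blast
qed

text \<open>The neighbourhoods of an end \<open>a = e0 y\<close> in the completion are governed by the last clause of
  \<open>C0_open\<close>. A family that runs into the path-components \<open>a E\<close> therefore converges to \<open>a\<close> in the
  completion, and pulling back along \<open>p0\<close> it converges to \<open>y\<close> in \<open>X\<close>.\<close>

lemma limitin_of_end:
  assumes ext: "externology X \<epsilon>" and hom: "homeomorphic_map X (C0 X \<epsilon>) (p0 X \<epsilon>)"
    and y: "y \<in> ext_limit \<epsilon>"
    and f: "\<And>E. E \<in> \<epsilon> \<Longrightarrow> \<forall>\<^sub>F t in F. f t \<in> E \<and> q0 (subtopology X E) (f t) = e0 X \<epsilon> y E"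
  shows "limitin X f y F"
  unfolding limitin_def
proof (intro conjI allI impI)
  show "y \<in> topspace X" using ext_limit_subset_topspace[OF ext] y by blast
  fix U assume U: "openin X U \<and> y \<in> U"
  have "C0_open X \<epsilon> (p0 X \<epsilon> ` U)"
    using homeomorphic_imp_open_map[OF hom] U openin_C0[OF ext]
    unfolding open_map_def by metis
  moreover have "in0 X \<epsilon> (e0 X \<epsilon> y) \<in> p0 X \<epsilon> ` U"
    using U p0_eq_in0_e0[OF ext y] by (metis imageI)
  ultimately obtain E G where E: "E \<in> \<epsilon>" "e0 X \<epsilon> y E \<in> G"
      "{x \<in> E. q0 (subtopology X E) x \<in> G} \<subseteq> {x \<in> topspace X. p0 X \<epsilon> x \<in> p0 X \<epsilon> ` U}"
    using e0_in_lim_pi0[OF ext y] unfolding C0_open_def by meson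
  have "{x \<in> topspace X. p0 X \<epsilon> x \<in> p0 X \<epsilon> ` U} \<subseteq> U"
    using homeomorphic_imp_injective_map[OF hom] U[THEN conjunct1, THEN openin_subset]
    by (auto dest: inj_onD)
  with E(3) have "{x \<in> E. q0 (subtopology X E) x \<in> G} \<subseteq> U" by (rule subset_trans)
  then have sub: "z \<in> U" if "z \<in> E" "q0 (subtopology X E) z \<in> G" for z
    using that by blast
  show "\<forall>\<^sub>F t in F. f t \<in> U"
    using f[OF E(1)] by (rule eventually_mono) (metis sub E(2))
qed

section \<open>Trajectories of flows\<close>

lemma flow_in_topspace:
  assumes "flow X \<phi>" "x \<in> topspace X"
  shows "\<phi> t x \<in> topspace X"
  using assms unfolding flow_def continuous_map_def by force

lemma flow_add:
  assumes "flow X \<phi>" "x \<in> topspace X"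
  shows "\<phi> s (\<phi> t x) = \<phi> (s + t) x"
  using assms unfolding flow_def by blast

lemma flow_zero:
  assumes "flow X \<phi>" "x \<in> topspace X"
  shows "\<phi> 0 x = x"
  using assms unfolding flow_def by blast

lemma continuous_map_trajectory:
  assumes "flow X \<phi>" "x \<in> topspace X"
  shows "continuous_map euclideanreal X (\<lambda>t. \<phi> t x)"
proof -
  have "continuous_map euclideanreal (prod_topology euclideanreal X) (\<lambda>t. (t, x))"
    using assms(2) by (intro continuous_map_pairedI) auto
  then have "continuous_map euclideanreal X ((\<lambda>(t, x). \<phi> t x) \<circ> (\<lambda>t. (t, x)))"
    using assms(1) unfolding flow_def by (blast intro: continuous_map_compose)
  then show ?thesis by (simp add: o_def)
qed

lemma continuous_map_time:
  assumes "flow X \<phi>"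
  shows "continuous_map X X (\<phi> t)"
proof -
  have "continuous_map X (prod_topology euclideanreal X) (\<lambda>x. (t, x))"
    by (intro continuous_map_pairedI) auto
  then have "continuous_map X X ((\<lambda>(t, x). \<phi> t x) \<circ> (\<lambda>x. (t, x)))"
    using assms unfolding flow_def by (blast intro: continuous_map_compose)
  then show ?thesis by (simp add: o_def)
qed

lemma path_component_of_trajectory:
  assumes "flow X \<phi>" "x \<in> topspace X" and seg: "\<And>u. u \<in> closed_segment s t \<Longrightarrow> \<phi> u x \<in> E"
  shows "path_component_of (subtopology X E) (\<phi> s x) (\<phi> t x)"
proof -
  define g where "g u = \<phi> ((1 - u) * s + u * t) x" for u
  have "continuous_map euclideanreal euclideanreal (\<lambda>u. (1 - u) * s + u * t)"
    by (simp add: continuous_intros)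
  then have "continuous_map euclideanreal X ((\<lambda>u. \<phi> u x) \<circ> (\<lambda>u. (1 - u) * s + u * t))"
    using continuous_map_trajectory[OF assms(1,2)] by (rule continuous_map_compose)
  then have "pathin X g"
    unfolding pathin_def g_def o_def by (rule continuous_map_from_subtopology)
  moreover have "g u \<in> E" if "u \<in> {0..1}" for u
    unfolding g_def using that by (intro seg) (auto simp: in_segment)
  ultimately have "pathin (subtopology X E) g"
    unfolding pathin_subtopology by blast
  then show ?thesis
    unfolding path_component_of_def by (intro exI[of _ g]) (simp add: g_def)
qed

text \<open>The externology is invariant under the flow, because shifting a trajectory in time does not
  change its tails.\<close>

lemma L_r_invariant:
  assumes fl: "flow X \<phi>" and x: "x \<in> L_r X \<phi>"
  shows "\<phi> t x \<in> L_r X \<phi>"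
  unfolding L_r_def ext_limit_def
proof
  fix E assume E: "E \<in> ext_r X \<phi>"
  let ?E = "{z \<in> topspace X. \<phi> t z \<in> E}"
  have "?E \<in> ext_r X \<phi>"
    unfolding ext_r_def
  proof (intro CollectI conjI ballI)
    show "openin X ?E"
      using continuous_map_time[OF fl] E
      by (auto simp: ext_r_def intro: openin_continuous_map_preimage)
    fix z assume z: "z \<in> topspace X"
    then obtain t0 where "\<forall>s > t0. \<phi> s z \<in> E"
      using E unfolding ext_r_def by blast
    then show "\<exists>t0. \<forall>s > t0. \<phi> s z \<in> ?E"
      using flow_add[OF fl z] flow_in_topspace[OF fl z] by (intro exI[of _ "t0 - t"]) auto
  qed
  then show "\<phi> t x \<in> E" using x unfolding L_r_def ext_limit_def by blast
qed

lemma critical_points_subset_L_r: "critical_points X \<phi> \<subseteq> L_r X \<phi>"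
proof
  fix x assume x: "x \<in> critical_points X \<phi>"
  have "x \<in> E" if E: "E \<in> ext_r X \<phi>" for E
  proof -
    have "x \<in> topspace X" using x by (simp add: critical_points_def)
    then obtain t0 where "\<forall>t > t0. \<phi> t x \<in> E"
      using E unfolding ext_r_def by blast
    then have "\<phi> (t0 + 1) x \<in> E" by simp
    then show ?thesis using x by (simp add: critical_points_def)
  qed
  then show "x \<in> L_r X \<phi>" unfolding L_r_def ext_limit_def by blast
qed

text \<open>The value at \<open>E\<close> is described as the set of points that the trajectory can eventually be
  joined to inside \<open>E\<close>; this names the path-component of the tail without choosing a time from
  which on the trajectory stays in \<open>E\<close>.\<close>

definition trajectory_end ::
  "'a topology \<Rightarrow> (real \<Rightarrow> 'a \<Rightarrow> 'a) \<Rightarrow> 'a \<Rightarrow> 'a set \<Rightarrow> 'a set" where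
  "trajectory_end X \<phi> x =
     (\<lambda>E \<in> ext_r X \<phi>. {z. \<forall>\<^sub>F t in at_top. path_component_of (subtopology X E) (\<phi> t x) z})"

lemma eventually_in_trajectory_end:
  assumes fl: "flow X \<phi>" and x: "x \<in> topspace X" and E: "E \<in> ext_r X \<phi>"
  shows "\<forall>\<^sub>F t in at_top. \<phi> t x \<in> E \<and> q0 (subtopology X E) (\<phi> t x) = trajectory_end X \<phi> x E"
proof -
  obtain t0 where t0: "\<And>t. t > t0 \<Longrightarrow> \<phi> t x \<in> E"
    using E x unfolding ext_r_def by blast
  have const: "q0 (subtopology X E) (\<phi> s x) = q0 (subtopology X E) (\<phi> t x)"
    if "s > t0" "t > t0" for s t
    using that t0 by (intro q0_eqI path_component_of_trajectory[OF fl x])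
      (auto simp: closed_segment_eq_real_ivl split: if_splits)
  have "q0 (subtopology X E) (\<phi> t x) = trajectory_end X \<phi> x E" if t: "t > t0" for t
  proof (intro set_eqI)
    fix z
    have *: "path_component_of (subtopology X E) (\<phi> s x) z
        \<longleftrightarrow> path_component_of (subtopology X E) (\<phi> t x) z" if "s > t0" for s
      using const[OF that t] by blast
    have "(\<forall>\<^sub>F s in at_top. path_component_of (subtopology X E) (\<phi> s x) z)
        \<longleftrightarrow> (\<forall>\<^sub>F s::real in at_top. path_component_of (subtopology X E) (\<phi> t x) z)"
      using eventually_gt_at_top[of t0] by (rule eventually_cong) (rule *)
    then show "z \<in> q0 (subtopology X E) (\<phi> t x) \<longleftrightarrow> z \<in> trajectory_end X \<phi> x E"
      using E by (simp add: trajectory_end_def)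
  qed
  then have "\<phi> t x \<in> E \<and> q0 (subtopology X E) (\<phi> t x) = trajectory_end X \<phi> x E"
    if "t > t0" for t
    using that t0 by blast
  with eventually_gt_at_top[of t0] show ?thesis by (rule eventually_mono)
qed

lemma trajectory_end_in_lim_pi0:
  assumes fl: "flow X \<phi>" and x: "x \<in> topspace X"
  shows "trajectory_end X \<phi> x \<in> topspace (lim_pi0 X (ext_r X \<phi>))"
  unfolding topspace_lim_pi0
proof (intro CollectI conjI PiE_I ballI impI)
  fix E assume E: "E \<in> ext_r X \<phi>"
  obtain t where "\<phi> t x \<in> E" "q0 (subtopology X E) (\<phi> t x) = trajectory_end X \<phi> x E"
    using eventually_happens'[OF _ eventually_in_trajectory_end[OF fl x E]] by auto
  then show "trajectory_end X \<phi> x E \<in> path_components_of (subtopology X E)"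
    using flow_in_topspace[OF fl x] by (auto simp: path_components_of_def)
next
  fix E assume "E \<notin> ext_r X \<phi>"
  then show "trajectory_end X \<phi> x E = undefined" by (simp add: trajectory_end_def)
next
  fix E E' z
  assume E: "E \<in> ext_r X \<phi>" and E': "E' \<in> ext_r X \<phi>" and sub: "E \<subseteq> E'"
    and z: "z \<in> trajectory_end X \<phi> x E"
  obtain t where t: "q0 (subtopology X E) (\<phi> t x) = trajectory_end X \<phi> x E"
      "q0 (subtopology X E') (\<phi> t x) = trajectory_end X \<phi> x E'"
    using eventually_happens'[OF _ eventually_conj[OF eventually_in_trajectory_end[OF fl x E]
        eventually_in_trajectory_end[OF fl x E']]] by auto
  have "path_component_of (subtopology X E) (\<phi> t x) z" using z t(1) by blast
  then show "q0 (subtopology X E') z = trajectory_end X \<phi> x E'"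
    using path_component_of_subtopology_mono[OF _ sub] q0_eqI t(2) by metis
qed

section \<open>Complete flows\<close>

lemma complete_trajectory_converges:
  assumes "C0_r_complete X \<phi>" "x \<in> topspace X"
  obtains y where "y \<in> L_r X \<phi>" "limitin X (\<lambda>t. \<phi> t x) y at_top"
proof -
  have fl: "flow X \<phi>" and hom: "homeomorphic_map X (C0 X (ext_r X \<phi>)) (p0 X (ext_r X \<phi>))"
    using assms(1) unfolding C0_r_complete_def by blast+
  note ext = externology_ext_r[OF fl]
  obtain y where y: "y \<in> ext_limit (ext_r X \<phi>)" "e0 X (ext_r X \<phi>) y = trajectory_end X \<phi> x"
    using e0_surj_on_ends[OF ext homeomorphic_imp_surjective_map[OF hom]
        trajectory_end_in_lim_pi0[OF fl assms(2)]] .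
  have "limitin X (\<lambda>t. \<phi> t x) y at_top"
    using ext hom y(1)
  proof (rule limitin_of_end)
    fix E assume "E \<in> ext_r X \<phi>"
    then show "\<forall>\<^sub>F t in at_top. \<phi> t x \<in> E
        \<and> q0 (subtopology X E) (\<phi> t x) = e0 X (ext_r X \<phi>) y E"
      unfolding y(2) by (rule eventually_in_trajectory_end[OF fl assms(2)])
  qed
  with y(1) that show ?thesis unfolding L_r_def by blast
qed

text \<open>Two points of an orbit in \<open>L\<close> are joined inside \<open>L\<close>, hence inside every exterior open set,
  so \<open>e0\<close> cannot tell them apart.\<close>

lemma complete_L_r_eq_critical_points:
  assumes "C0_r_complete X \<phi>"
  shows "L_r X \<phi> = critical_points X \<phi>"
proof
  have fl: "flow X \<phi>" and hom: "homeomorphic_map X (C0 X (ext_r X \<phi>)) (p0 X (ext_r X \<phi>))"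
    using assms unfolding C0_r_complete_def by blast+
  note ext = externology_ext_r[OF fl]
  show "L_r X \<phi> \<subseteq> critical_points X \<phi>"
  proof
    fix x assume x: "x \<in> L_r X \<phi>"
    then have xX: "x \<in> topspace X"
      using ext_limit_subset_topspace[OF ext] unfolding L_r_def by blast
    have "\<phi> t x = x" for t
    proof -
      have "q0 (subtopology X E) (\<phi> t x) = q0 (subtopology X E) x" if "E \<in> ext_r X \<phi>" for E
      proof -
        have "\<phi> u x \<in> E" for u
          using L_r_invariant[OF fl x] that unfolding L_r_def ext_limit_def by blast
        then have "path_component_of (subtopology X E) (\<phi> t x) (\<phi> 0 x)"
          by (intro path_component_of_trajectory[OF fl xX])
        then show ?thesis unfolding flow_zero[OF fl xX] by (rule q0_eqI)
      qed
      then have "e0 X (ext_r X \<phi>) (\<phi> t x) = e0 X (ext_r X \<phi>) x"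
        unfolding e0_def by (rule restrict_ext)
      then show ?thesis
        using inj_onD[OF e0_inj_on_limit[OF ext homeomorphic_imp_injective_map[OF hom]]]
          x L_r_invariant[OF fl x] unfolding L_r_def by blast
    qed
    with xX show "x \<in> critical_points X \<phi>" unfolding critical_points_def by blast
  qed
qed (rule critical_points_subset_L_r)

section \<open>Limit sets of convergent trajectories\<close>

lemma limitin_in_omega_limit:
  assumes fl: "flow X \<phi>" "x \<in> topspace X" and lim: "limitin X (\<lambda>t. \<phi> t x) y at_top"
  shows "y \<in> omega_limit X \<phi> x"
  unfolding omega_limit_def
proof
  fix t :: real
  show "y \<in> X closure_of (\<lambda>s. \<phi> s x) ` {t..}"
    unfolding in_closure_of
  proof (intro conjI allI impI)
    show "y \<in> topspace X" using lim by (rule limitin_topspace)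
    fix U assume "y \<in> U \<and> openin X U"
    then have "\<forall>\<^sub>F s in at_top. \<phi> s x \<in> U" using lim unfolding limitin_def by blast
    then have "\<exists>s. \<phi> s x \<in> U \<and> s \<ge> t"
      using eventually_happens'[OF _ eventually_conj[OF _ eventually_ge_at_top[of t]]] by auto
    then show "\<exists>z. z \<in> (\<lambda>s. \<phi> s x) ` {t..} \<and> z \<in> U" by auto
  qed
qed

lemma omega_limit_critical:
  assumes "x \<in> critical_points X \<phi>"
  shows "omega_limit X \<phi> x = X closure_of {x}"
proof -
  have "(\<lambda>s. \<phi> s x) ` {t..} = {x}" for t
    using assms by (auto simp: critical_points_def)
  then show ?thesis by (auto simp: omega_limit_def)
qed

text \<open>Disjoint neighbourhoods of the limit and of another point separate that point from a whole
  tail of the trajectory.\<close>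

lemma omega_limit_Hausdorff:
  assumes haus: "Hausdorff_space X" and fl: "flow X \<phi>" and x: "x \<in> topspace X"
    and lim: "limitin X (\<lambda>t. \<phi> t x) y at_top"
  shows "omega_limit X \<phi> x = {y}"
proof (intro equalityI subsetI)
  fix z assume z: "z \<in> omega_limit X \<phi> x"
  have cl: "z \<in> X closure_of (\<lambda>s. \<phi> s x) ` {t..}" if "t \<ge> 0" for t
    using z that unfolding omega_limit_def by auto
  have zX: "z \<in> topspace X" using cl[OF order_refl] by (simp add: in_closure_of)
  have "z = y"
  proof (rule ccontr)
    assume "z \<noteq> y"
    then obtain U V where UV: "openin X U" "openin X V" "z \<in> U" "y \<in> V" "disjnt U V"
      using haus zX limitin_topspace[OF lim] unfolding Hausdorff_space_def by meson
    have "\<forall>\<^sub>F t in at_top. \<phi> t x \<in> V" using lim UV unfolding limitin_def by blast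
    then obtain t0 where t0: "\<And>t. t \<ge> t0 \<Longrightarrow> \<phi> t x \<in> V"
      unfolding eventually_at_top_linorder by blast
    have "z \<in> X closure_of (\<lambda>s. \<phi> s x) ` {max 0 t0..}" by (rule cl) simp
    then obtain s where "s \<ge> max 0 t0" "\<phi> s x \<in> U"
      using UV(1,3) unfolding in_closure_of by blast
    then show False using t0[of s] UV(5) by (auto simp: disjnt_iff)
  qed
  then show "z \<in> {y}" by simp
next
  fix z assume "z \<in> {y}"
  then show "z \<in> omega_limit X \<phi> x" using limitin_in_omega_limit[OF fl x lim] by simp
qed

lemma flow_period_multiple:
  assumes fl: "flow X \<phi>" and x: "x \<in> topspace X" and r: "\<phi> r x = x"
  shows "\<phi> (real n * r) x = x"
proof (induction n)
  case 0
  then show ?case using flow_zero[OF fl x] by simp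
next
  case (Suc n)
  have "\<phi> (real (Suc n) * r) x = \<phi> (real n * r) (\<phi> r x)"
    unfolding flow_add[OF fl x] by (simp add: algebra_simps)
  then show ?case using Suc r by simp
qed

text \<open>A periodic trajectory returns to its starting point at arbitrarily late times, so that point
  lies in every neighbourhood of a limit of the trajectory.\<close>

lemma periodic_limitin_eq:
  assumes t1: "t1_space X" and fl: "flow X \<phi>" and x: "x \<in> periodic_points X \<phi>"
    and lim: "limitin X (\<lambda>t. \<phi> t x) y at_top"
  shows "y = x"
proof (rule ccontr)
  assume "y \<noteq> x"
  obtain r where xX: "x \<in> topspace X" and r: "r \<noteq> 0" "\<phi> r x = x"
    using x unfolding periodic_points_def by blast
  have per: "\<exists>p > 0. \<phi> p x = x"
  proof (cases "r > 0")
    case False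
    have "\<phi> (- r) x = \<phi> (- r) (\<phi> r x)" using r(2) by simp
    also have "\<dots> = x" using flow_add[OF fl xX] flow_zero[OF fl xX] by simp
    finally show ?thesis using False r(1) by (intro exI[of _ "- r"]) simp
  qed (use r in blast)
  then obtain p where p: "p > 0" "\<phi> p x = x" by blast
  have "openin X (topspace X - {x})"
    using t1 xX by (simp add: closedin_t1_singleton openin_diff)
  then have "\<forall>\<^sub>F t in at_top. \<phi> t x \<in> topspace X - {x}"
    using lim limitin_topspace[OF lim] \<open>y \<noteq> x\<close> unfolding limitin_def by blast
  then obtain t0 where t0: "\<And>t. t \<ge> t0 \<Longrightarrow> \<phi> t x \<noteq> x"
    unfolding eventually_at_top_linorder by blast
  obtain n :: nat where "t0 < real n * p"
    using reals_Archimedean3[OF p(1)] by blast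
  then show False using t0[of "real n * p"] flow_period_multiple[OF fl xX p(2)] by simp
qed

lemma closedin_critical_points:
  assumes "Hausdorff_space X" "flow X \<phi>"
  shows "closedin X (critical_points X \<phi>)"
proof -
  have "critical_points X \<phi> = topspace X \<inter> (\<Inter>t. {x \<in> topspace X. \<phi> t x = x})"
    by (auto simp: critical_points_def)
  moreover have "closedin X {x \<in> topspace X. \<phi> t x = x}" for t
    using closedin_continuous_maps_eq[OF assms(1) continuous_map_time[OF assms(2)]
        continuous_map_id] by simp
  ultimately show ?thesis by (auto intro!: closedin_Int closedin_INT)
qed

section \<open>Attractors of complete flows\<close>

lemma complete_weak_attractor:
  assumes "C0_r_complete X \<phi>"
  shows "global_weak_attractor X \<phi> (L_r X \<phi>)"
proof -
  have fl: "flow X \<phi>" using assms by (simp add: C0_r_complete_def)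
  have "invariant_subset X \<phi> (L_r X \<phi>)"
    unfolding complete_L_r_eq_critical_points[OF assms]
    by (simp add: invariant_subset_def critical_points_def)
  moreover have "omega_limit X \<phi> x \<inter> L_r X \<phi> \<noteq> {}" if "x \<in> topspace X" for x
    using complete_trajectory_converges[OF assms that] limitin_in_omega_limit[OF fl that] by blast
  ultimately show ?thesis by (simp add: global_weak_attractor_def)
qed

lemma critical_points_subset_weak_attractor:
  assumes "t1_space X" "global_weak_attractor X \<phi> M"
  shows "critical_points X \<phi> \<subseteq> M"
proof
  fix x assume x: "x \<in> critical_points X \<phi>"
  then have xX: "x \<in> topspace X" by (simp add: critical_points_def)
  have "closedin X {x}" using assms(1) xX by (simp add: closedin_t1_singleton)
  then have "omega_limit X \<phi> x = {x}"
    using omega_limit_critical[OF x] by (simp add: closure_of_closedin)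
  then show "x \<in> M" using assms(2) xX by (auto simp: global_weak_attractor_def)
qed

lemma complete_L_r_eq_periodic_points:
  assumes comp: "C0_r_complete X \<phi>" and t1: "t1_space X"
  shows "L_r X \<phi> = periodic_points X \<phi>"
proof
  show "L_r X \<phi> \<subseteq> periodic_points X \<phi>"
    unfolding complete_L_r_eq_critical_points[OF comp] critical_points_def periodic_points_def
    by (auto intro: exI[of _ 1])
  show "periodic_points X \<phi> \<subseteq> L_r X \<phi>"
  proof
    fix x assume x: "x \<in> periodic_points X \<phi>"
    then have "x \<in> topspace X" by (simp add: periodic_points_def)
    then obtain y where "y \<in> L_r X \<phi>" "limitin X (\<lambda>t. \<phi> t x) y at_top"
      using complete_trajectory_converges[OF comp] by blast
    then show "x \<in> L_r X \<phi>"
      using periodic_limitin_eq[OF t1 _ x] comp unfolding C0_r_complete_def by metis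
  qed
qed

lemma complete_omega_limit_Hausdorff:
  assumes comp: "C0_r_complete X \<phi>" and haus: "Hausdorff_space X" and x: "x \<in> topspace X"
  obtains y where "y \<in> L_r X \<phi>" "omega_limit X \<phi> x = {y}"
  using complete_trajectory_converges[OF comp x] omega_limit_Hausdorff[OF haus _ x] comp
  unfolding C0_r_complete_def by metis

lemma complete_global_attractor:
  assumes comp: "C0_r_complete X \<phi>" and haus: "Hausdorff_space X"
  shows "global_attractor X \<phi> (L_r X \<phi>)"
proof -
  have "invariant_subset X \<phi> (L_r X \<phi>)"
    using complete_weak_attractor[OF comp] by (simp add: global_weak_attractor_def)
  moreover have "omega_limit X \<phi> x \<noteq> {} \<and> omega_limit X \<phi> x \<subseteq> L_r X \<phi>"
    if "x \<in> topspace X" for x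
    using complete_omega_limit_Hausdorff[OF comp haus that] by (metis empty_not_insert
        empty_subsetI insert_subset)
  ultimately show ?thesis by (simp add: global_attractor_def)
qed

lemma complete_Omega_eq_L_r:
  assumes comp: "C0_r_complete X \<phi>" and haus: "Hausdorff_space X"
  shows "Omega X \<phi> = L_r X \<phi>"
proof
  show "Omega X \<phi> \<subseteq> L_r X \<phi>"
    using complete_global_attractor[OF comp haus] unfolding Omega_def global_attractor_def by blast
  show "L_r X \<phi> \<subseteq> Omega X \<phi>"
  proof
    fix x assume "x \<in> L_r X \<phi>"
    then have x: "x \<in> critical_points X \<phi>" using complete_L_r_eq_critical_points[OF comp] by simp
    then have xX: "x \<in> topspace X" by (simp add: critical_points_def)
    then have "x \<in> omega_limit X \<phi> x"
      unfolding omega_limit_critical[OF x] using closure_of_subset[of "{x}" X] by simp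
    with xX show "x \<in> Omega X \<phi>" unfolding Omega_def by blast
  qed
qed

text \<open>Every open set around \<open>L\<close> absorbs all trajectories, since they converge to points of \<open>L\<close>.\<close>

lemma complete_open_superset_exterior:
  assumes comp: "C0_r_complete X \<phi>" and V: "openin X V" "L_r X \<phi> \<subseteq> V"
  shows "V \<in> ext_r X \<phi>"
  unfolding ext_r_def
proof (intro CollectI conjI ballI)
  fix x assume "x \<in> topspace X"
  then obtain y where "y \<in> L_r X \<phi>" "limitin X (\<lambda>t. \<phi> t x) y at_top"
    using complete_trajectory_converges[OF comp] by blast
  then have "\<forall>\<^sub>F t in at_top. \<phi> t x \<in> V" using V unfolding limitin_def by blast
  then show "\<exists>t0. \<forall>t > t0. \<phi> t x \<in> V" unfolding eventually_at_top_dense .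
qed (fact V(1))

lemma complete_L_bar_r_eq_L_r:
  assumes comp: "C0_r_complete X \<phi>" and haus: "Hausdorff_space X" and reg: "regular_space X"
  shows "L_bar_r X \<phi> = L_r X \<phi>"
proof (intro equalityI subsetI)
  have fl: "flow X \<phi>" using comp by (simp add: C0_r_complete_def)
  have closed: "closedin X (L_r X \<phi>)"
    unfolding complete_L_r_eq_critical_points[OF comp]
    by (rule closedin_critical_points[OF haus fl])
  fix x assume x: "x \<in> L_bar_r X \<phi>"
  have "topspace X \<in> ext_r X \<phi>"
    using complete_open_superset_exterior[OF comp openin_topspace] closedin_subset[OF closed] .
  then have xX: "x \<in> topspace X"
    using x closure_of_subset_topspace unfolding L_bar_r_def ext_bar_limit_def by fast
  show "x \<in> L_r X \<phi>"
  proof (rule ccontr)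
    assume "x \<notin> L_r X \<phi>"
    then obtain U V where UV: "openin X U" "openin X V" "x \<in> U" "L_r X \<phi> \<subseteq> V" "disjnt U V"
      using reg closed xX unfolding regular_space_def by (meson DiffI)
    have "x \<in> X closure_of V"
      using complete_open_superset_exterior[OF comp UV(2,4)] x
      unfolding L_bar_r_def ext_bar_limit_def by blast
    then show False using UV(1,3,5) unfolding in_closure_of disjnt_iff by blast
  qed
next
  have fl: "flow X \<phi>" using comp by (simp add: C0_r_complete_def)
  fix x assume x: "x \<in> L_r X \<phi>"
  have "x \<in> X closure_of E" if "E \<in> ext_r X \<phi>" for E
    using x that closure_of_subset[of E X] openin_subset[of X E]
    unfolding L_r_def ext_limit_def ext_r_def by blast
  then show "x \<in> L_bar_r X \<phi>" unfolding L_bar_r_def ext_bar_limit_def by blast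
qed

theorem theorem6p1:
  fixes X :: "'a topology" and \<phi> :: "real \<Rightarrow> 'a \<Rightarrow> 'a"
  assumes "C0_r_complete X \<phi>"
  shows "(global_weak_attractor X \<phi> (L_r X \<phi>) \<and> L_r X \<phi> = critical_points X \<phi>)
    \<and> (t1_space X \<longrightarrow>
         inclusion_minimal (global_weak_attractor X \<phi>) (L_r X \<phi>) \<and>
         L_r X \<phi> = periodic_points X \<phi>)
    \<and> (Hausdorff_space X \<longrightarrow>
         inclusion_minimal (global_attractor X \<phi>) (L_r X \<phi>) \<and>
         (\<forall>M. inclusion_minimal (global_attractor X \<phi>) M \<longrightarrow> M = L_r X \<phi>) \<and>
         L_r X \<phi> = X closure_of (Omega X \<phi>))
    \<and> (locally_compact_space X \<and> regular_space X \<and> t1_space X \<longrightarrow>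
         L_r X \<phi> = X closure_of (Omega X \<phi>) \<and>
         X closure_of (Omega X \<phi>) = L_bar_r X \<phi>)"
proof -
  have fl: "flow X \<phi>" using assms by (simp add: C0_r_complete_def)
  note crit = complete_L_r_eq_critical_points[OF assms]
  have least_weak: "L_r X \<phi> \<subseteq> M" if "t1_space X" "global_weak_attractor X \<phi> M" for M
    unfolding crit using critical_points_subset_weak_attractor[OF that] .
  have least: "L_r X \<phi> \<subseteq> M" if "Hausdorff_space X" "global_attractor X \<phi> M" for M
  proof (rule least_weak)
    show "t1_space X" using that(1) by (rule Hausdorff_imp_t1_space)
    show "global_weak_attractor X \<phi> M"
      using that(2) unfolding global_attractor_def global_weak_attractor_def by blast
  qed
  have omega: "L_r X \<phi> = X closure_of (Omega X \<phi>)" if "Hausdorff_space X"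
    using closure_of_closedin[OF closedin_critical_points[OF that fl]]
    unfolding complete_Omega_eq_L_r[OF assms that] crit by simp
  have T3: "Hausdorff_space X" if "regular_space X" "t1_space X"
    using that regular_t1_imp_Hausdorff_space by blast
  have i: "global_weak_attractor X \<phi> (L_r X \<phi>)"
    by (rule complete_weak_attractor[OF assms])
  have ii: "inclusion_minimal (global_weak_attractor X \<phi>) (L_r X \<phi>) \<and>
      L_r X \<phi> = periodic_points X \<phi>" if "t1_space X"
    using i least_weak[OF that] complete_L_r_eq_periodic_points[OF assms that]
    unfolding inclusion_minimal_def by blast
  have iii: "inclusion_minimal (global_attractor X \<phi>) (L_r X \<phi>) \<and>
      (\<forall>M. inclusion_minimal (global_attractor X \<phi>) M \<longrightarrow> M = L_r X \<phi>)" if "Hausdorff_space X"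
    using complete_global_attractor[OF assms that] least[OF that]
    unfolding inclusion_minimal_def by blast
  have iv: "X closure_of (Omega X \<phi>) = L_bar_r X \<phi>" if "regular_space X" "t1_space X"
    using complete_L_bar_r_eq_L_r[OF assms T3[OF that] that(1)] omega[OF T3[OF that]] by simp
  show ?thesis using i crit ii iii omega iv T3 by blast
qed

end
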